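(* Let $k\ge1$ be an integer, and consider the linear parabolic equation with periodic boundary conditions $$u_t=A_{11}u_{xx}+(A_{12}+A_{21})u_{xy}+A_{22}u_{yy},\qquad (x,y)\in[0,2\pi]^2,$$ where the coefficients $A_{ij}$ are real constants; parabolic means that there is $\theta>0$ with $\sum_{i,j=1}^2A_{ij}\xi_i\xi_j\ge\theta(\xi_1^2+\xi_2^2)$ for all $(\xi_1,\xi_2)\in\mathbb{R}^2$. Consider the scheme combining forward Euler time stepping with step $\Delta t$ and the $k$-term kernel-based approximations of the spatial derivatives, with parameter $\beta>0$: $$u^{n+1}=u^n+\Delta t\left(A_{11}\,\partial^{(k)}_x\partial^{(k)}_x+A_{12}\,\partial^{(k)}_y\partial^{(k)}_x+A_{21}\,\partial^{(k)}_x\partial^{(k)}_y+A_{22}\,\partial^{(k)}_y\partial^{(k)}_y\right)u^n,$$ where $\partial_x^{(k)},\partial_y^{(k)}$ are the operators defined in the context with $\alpha_{0,x}=\sqrt{\beta/(A_{11}\Delta t)}$ and $\alpha_{0,y}=\sqrt{\beta/(A_{22}\Delta t)}$. Let $\beta_{2,k,\max}$ be the constant defined in the context. Then: 1. If $A_{12}=A_{21}=0$, the scheme is A-stable whenever $0<\beta\le\frac12\beta_{2,k,\max}$. 2. Otherwise, the scheme is A-stable whenever $0<\beta\le\frac14\beta_{2,k,\max}$.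
   Context: One-dimensional operators. For an interval $[a,b]$ (here $[0,2\pi]$) and $\alpha>0$, put $\mu=e^{-\alpha(b-a)}$. For a continuous (complex-valued) function $v$ on $[a,b]$ define $$I^{L}[v,\alpha](x)=\alpha\int_a^x e^{-\alpha(x-y)}v(y)\,dy,\qquad I^{R}[v,\alpha](x)=\alpha\int_x^b e^{-\alpha(y-x)}v(y)\,dy,$$ $$\mathcal{L}_L^{-1}[v,\alpha](x)=I^L[v,\alpha](x)+\frac{I^L[v,\alpha](b)}{1-\mu}e^{-\alpha(x-a)},\qquad \mathcal{L}_R^{-1}[v,\alpha](x)=I^R[v,\alpha](x)+\frac{I^R[v,\alpha](a)}{1-\mu}e^{-\alpha(b-x)}.$$ These are the inverses of $\mathcal{I}+\frac1\alpha\partial_x$ and $\mathcal{I}-\frac1\alpha\partial_x$ ($\mathcal{I}$ the identity) normalized so that the output takes equal values at $a$ and $b$. Define $$\mathcal{D}_L=\mathcal{I}-\mathcal{L}_L^{-1},\qquad \mathcal{D}_R=\mathcal{I}-\mathcal{L}_R^{-1},\qquad \mathcal{D}_0=\tfrac12(\mathcal{D}_L+\mathcal{D}_R),$$ with powers and products denoting composition and $\mathcal{D}_0^0=\mathcal{I}$. Two-dimensional operators. For a function $u(x,y)$ on $[0,2\pi]^2$, a subscript $x$ (resp. $y$) on $\mathcal{D}_L,\mathcal{D}_R,\mathcal{D}_0$ means that the operator is applied in the variable $x$ for each fixed $y$ with parameter $\alpha_{0,x}$ (resp. in $y$ for each fixed $x$ with parameter $\alpha_{0,y}$). Set $$\partial_x^{(k)}=\frac{\alpha_{0,x}}{2}\sum_{p=1}^{k}\mathcal{D}_{0,x}^{\,p-1}(\mathcal{D}_{L,x}-\mathcal{D}_{R,x}),\qquad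 \partial_y^{(k)}=\frac{\alpha_{0,y}}{2}\sum_{p=1}^{k}\mathcal{D}_{0,y}^{\,p-1}(\mathcal{D}_{L,y}-\mathcal{D}_{R,y}).$$ The integrals are evaluated exactly (no spatial discretization). The constant $\beta_{2,k,\max}$. It is the stability bound for the one-dimensional scheme, $\beta_{2,k,\max}=2/M_k$, where $M_k=\sup_{z\in\mathbb{R}}z^2\left(1-\left(\frac{z^2}{1+z^2}\right)^k\right)^2\in(0,\infty)$. A-stability is meant in the von Neumann sense, unconditionally in the time step: for every $\Delta t>0$ and every Fourier mode $u^n(x,y)=\hat u\,e^{i\xi x+i\eta y}$ with $\xi,\eta\in\mathbb{Z}$, one has $u^{n+1}=\hat Q\,u^n$ with an amplification factor $\hat Q$ satisfying $|\hat Q|\le1$. *)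

theory Defs
  imports "HOL-Analysis.Analysis"
begin

section \<open>One-dimensional operators on an interval [a, b]\<close>

definition mu :: "real \<Rightarrow> real \<Rightarrow> real \<Rightarrow> real" where
  "mu a b \<alpha> = exp (- \<alpha> * (b - a))"

definition I_L :: "real \<Rightarrow> real \<Rightarrow> real \<Rightarrow> (real \<Rightarrow> complex) \<Rightarrow> real \<Rightarrow> complex" where
  "I_L a b \<alpha> v x = of_real \<alpha> * integral {a..x} (\<lambda>y. of_real (exp (- \<alpha> * (x - y))) * v y)"

definition I_R :: "real \<Rightarrow> real \<Rightarrow> real \<Rightarrow> (real \<Rightarrow> complex) \<Rightarrow> real \<Rightarrow> complex" where
  "I_R a b \<alpha> v x = of_real \<alpha> * integral {x..b} (\<lambda>y. of_real (exp (- \<alpha> * (y - x))) * v y)"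

definition Linv_L :: "real \<Rightarrow> real \<Rightarrow> real \<Rightarrow> (real \<Rightarrow> complex) \<Rightarrow> real \<Rightarrow> complex" where
  "Linv_L a b \<alpha> v x =
     I_L a b \<alpha> v x + I_L a b \<alpha> v b / of_real (1 - mu a b \<alpha>) * of_real (exp (- \<alpha> * (x - a)))"

definition Linv_R :: "real \<Rightarrow> real \<Rightarrow> real \<Rightarrow> (real \<Rightarrow> complex) \<Rightarrow> real \<Rightarrow> complex" where
  "Linv_R a b \<alpha> v x =
     I_R a b \<alpha> v x + I_R a b \<alpha> v a / of_real (1 - mu a b \<alpha>) * of_real (exp (- \<alpha> * (b - x)))"

definition D_L :: "real \<Rightarrow> real \<Rightarrow> real \<Rightarrow> (real \<Rightarrow> complex) \<Rightarrow> real \<Rightarrow> complex" where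
  "D_L a b \<alpha> v x = v x - Linv_L a b \<alpha> v x"

definition D_R :: "real \<Rightarrow> real \<Rightarrow> real \<Rightarrow> (real \<Rightarrow> complex) \<Rightarrow> real \<Rightarrow> complex" where
  "D_R a b \<alpha> v x = v x - Linv_R a b \<alpha> v x"

definition D_0 :: "real \<Rightarrow> real \<Rightarrow> real \<Rightarrow> (real \<Rightarrow> complex) \<Rightarrow> real \<Rightarrow> complex" where
  "D_0 a b \<alpha> v x = (D_L a b \<alpha> v x + D_R a b \<alpha> v x) / 2"

section \<open>Two-dimensional operators on [0, 2 pi] x [0, 2 pi]\<close>

text \<open>A function on the square is a total function \<open>real \<Rightarrow> real \<Rightarrow> complex\<close>; at points of the
  square the operators depend only on its values on the square, and only those points matter
  in \<open>A_stable\<close> below.\<close>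

type_synonym fun2 = "real \<Rightarrow> real \<Rightarrow> complex"

definition in_x :: "((real \<Rightarrow> complex) \<Rightarrow> real \<Rightarrow> complex) \<Rightarrow> fun2 \<Rightarrow> fun2" where
  "in_x T u = (\<lambda>x y. T (\<lambda>s. u s y) x)"

definition in_y :: "((real \<Rightarrow> complex) \<Rightarrow> real \<Rightarrow> complex) \<Rightarrow> fun2 \<Rightarrow> fun2" where
  "in_y T u = (\<lambda>x y. T (\<lambda>s. u x s) y)"

definition partial_x :: "real \<Rightarrow> nat \<Rightarrow> fun2 \<Rightarrow> fun2" where
  "partial_x \<alpha> k u = (\<lambda>x y. of_real (\<alpha> / 2) *
     (\<Sum>p = 1..k. (in_x (D_0 0 (2 * pi) \<alpha>) ^^ (p - 1))
        (\<lambda>x y. in_x (D_L 0 (2 * pi) \<alpha>) u x y - in_x (D_R 0 (2 * pi) \<alpha>) u x y) x y))"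

definition partial_y :: "real \<Rightarrow> nat \<Rightarrow> fun2 \<Rightarrow> fun2" where
  "partial_y \<alpha> k u = (\<lambda>x y. of_real (\<alpha> / 2) *
     (\<Sum>p = 1..k. (in_y (D_0 0 (2 * pi) \<alpha>) ^^ (p - 1))
        (\<lambda>x y. in_y (D_L 0 (2 * pi) \<alpha>) u x y - in_y (D_R 0 (2 * pi) \<alpha>) u x y) x y))"

section \<open>The scheme and its stability\<close>

definition parabolic :: "real^2^2 \<Rightarrow> bool" where
  "parabolic A \<longleftrightarrow> (\<exists>\<theta>>0. \<forall>\<xi>::real^2.
     (\<Sum>i\<in>UNIV. \<Sum>j\<in>UNIV. A $ i $ j * \<xi> $ i * \<xi> $ j) \<ge> \<theta> * ((\<xi> $ 1)\<^sup>2 + (\<xi> $ 2)\<^sup>2))"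

text \<open>One forward Euler step with step size \<open>dt\<close>, mapping \<open>u\<^sup>n\<close> to \<open>u\<^sup>n\<^sup>+\<^sup>1\<close>.\<close>

definition scheme_step :: "real^2^2 \<Rightarrow> nat \<Rightarrow> real \<Rightarrow> real \<Rightarrow> fun2 \<Rightarrow> fun2" where
  "scheme_step A k \<beta> dt u =
     (let Px = partial_x (sqrt (\<beta> / (A $ 1 $ 1 * dt))) k;
          Py = partial_y (sqrt (\<beta> / (A $ 2 $ 2 * dt))) k
      in (\<lambda>x y. u x y + of_real dt *
            (of_real (A $ 1 $ 1) * Px (Px u) x y + of_real (A $ 1 $ 2) * Py (Px u) x y
           + of_real (A $ 2 $ 1) * Px (Py u) x y + of_real (A $ 2 $ 2) * Py (Py u) x y)))"

definition fourier_mode :: "complex \<Rightarrow> int \<Rightarrow> int \<Rightarrow> fun2" where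
  "fourier_mode c \<xi> \<eta> = (\<lambda>x y. c * exp (\<i> * of_int \<xi> * of_real x + \<i> * of_int \<eta> * of_real y))"

text \<open>The argument \<open>S\<close> of \<open>A_stable\<close> maps a time step to the one-step operator. The
  amplification factor \<open>Q\<close> may depend on the time step and the frequencies, but not on the
  amplitude \<open>c\<close> of the mode.\<close>

definition A_stable :: "(real \<Rightarrow> fun2 \<Rightarrow> fun2) \<Rightarrow> bool" where
  "A_stable S \<longleftrightarrow> (\<forall>dt>0. \<forall>\<xi> \<eta>. \<exists>Q. cmod Q \<le> 1 \<and>
     (\<forall>c. \<forall>x\<in>{0..2 * pi}. \<forall>y\<in>{0..2 * pi}.
        S dt (fourier_mode c \<xi> \<eta>) x y = Q * fourier_mode c \<xi> \<eta> x y))"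

definition M_sup :: "nat \<Rightarrow> real" where
  "M_sup k = (SUP z::real. z\<^sup>2 * (1 - (z\<^sup>2 / (1 + z\<^sup>2)) ^ k)\<^sup>2)"

definition beta2_max :: "nat \<Rightarrow> real" where
  "beta2_max k = 2 / M_sup k"

text \<open>The supremum defining \<open>M_sup\<close> is that of a bounded set, and it is positive for \<open>k \<ge> 1\<close>.\<close>

lemma M_sup_bdd_above: "bdd_above (range (\<lambda>z::real. z\<^sup>2 * (1 - (z\<^sup>2 / (1 + z\<^sup>2)) ^ k)\<^sup>2))"
proof (rule bdd_aboveI2)
  fix z :: real
  define r where "r = z\<^sup>2 / (1 + z\<^sup>2)"
  have pos: "1 + z\<^sup>2 > 0" by (simp add: add_pos_nonneg)
  have r: "0 \<le> r" "r \<le> 1" using pos by (auto simp: r_def divide_simps)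
  have r1: "1 - r = 1 / (1 + z\<^sup>2)" using pos by (simp add: r_def field_simps)
  have "1 + real k * (r - 1) \<le> (1 + (r - 1)) ^ k"
    using r by (intro Bernoulli_inequality) auto
  hence "1 - r ^ k \<le> real k * (1 - r)" by (simp add: algebra_simps)
  moreover have "0 \<le> 1 - r ^ k" using r by (simp add: power_le_one)
  ultimately have "(1 - r ^ k)\<^sup>2 \<le> (real k * (1 - r))\<^sup>2" by (intro power_mono)
  also have "\<dots> = (real k)\<^sup>2 * ((1 - r) * (1 - r))" by (simp add: power2_eq_square algebra_simps)
  finally have "z\<^sup>2 * (1 - r ^ k)\<^sup>2 \<le> z\<^sup>2 * ((real k)\<^sup>2 * ((1 - r) * (1 - r)))"
    by (intro mult_left_mono) auto
  also have "\<dots> = (real k)\<^sup>2 * (r * (1 - r))"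
    by (simp add: r1) (simp add: r_def)
  also have "\<dots> \<le> (real k)\<^sup>2 * 1"
    using r by (intro mult_left_mono mult_le_one) auto
  finally show "z\<^sup>2 * (1 - (z\<^sup>2 / (1 + z\<^sup>2)) ^ k)\<^sup>2 \<le> (real k)\<^sup>2" by (simp add: r_def)
qed

lemma M_sup_pos:
  assumes "k \<ge> 1"
  shows "M_sup k > 0"
proof -
  have "(1/2::real) ^ k \<le> (1/2) ^ 1" using assms by (intro power_decreasing) auto
  hence "0 < (1::real)\<^sup>2 * (1 - (1\<^sup>2 / (1 + 1\<^sup>2)) ^ k)\<^sup>2" by simp
  also have "\<dots> \<le> M_sup k" unfolding M_sup_def by (intro cSUP_upper M_sup_bdd_above) auto
  finally show ?thesis .
qed

end

theory Submission
  imports Defs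
begin

text \<open>Every Fourier mode is an eigenfunction of all the operators involved. With \<open>w = \<xi> / \<alpha>\<close> and
  \<open>r = w\<^sup>2 / (1 + w\<^sup>2)\<close>, the operators \<open>D_L\<close>, \<open>D_R\<close>, \<open>D_0\<close> have the eigenvalues
  \<open>\<i>w / (1 + \<i>w)\<close>, \<open>-\<i>w / (1 - \<i>w)\<close>, \<open>r\<close>, and summing the geometric series gives the eigenvalue
  \<open>\<i>\<alpha>g\<close> with \<open>g = w (1 - r\<^sup>k)\<close> for the approximate derivative. By the choice of the parameters
  \<open>\<alpha>\<close> the amplification factor is \<open>1 - \<beta> (g\<^sub>x\<^sup>2 + c g\<^sub>x g\<^sub>y + g\<^sub>y\<^sup>2)\<close> where
  \<open>c = (A\<^sub>1\<^sub>2 + A\<^sub>2\<^sub>1) / sqrt (A\<^sub>1\<^sub>1 A\<^sub>2\<^sub>2)\<close>. Parabolicity gives \<open>\<bar>c\<bar> \<le> 2\<close>, so the quadratic form lies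
  between \<open>0\<close> and \<open>2 (g\<^sub>x\<^sup>2 + g\<^sub>y\<^sup>2) \<le> 4 M\<^sub>k\<close>, and is at most \<open>2 M\<^sub>k\<close> if \<open>c = 0\<close>.\<close>

section \<open>Eigenvalues of the one-dimensional operators\<close>

text \<open>Agreement with the exponential is only required on \<open>[a, b]\<close>: outside the interval the
  operators do not reproduce it.\<close>

definition symbol1 :: "real \<Rightarrow> real \<Rightarrow> complex \<Rightarrow> ((real \<Rightarrow> complex) \<Rightarrow> real \<Rightarrow> complex) \<Rightarrow> complex \<Rightarrow> bool" where
  "symbol1 a b z T l \<longleftrightarrow> (\<forall>v d. (\<forall>s\<in>{a..b}. v s = d * exp (z * of_real s)) \<longrightarrow>
     (\<forall>s\<in>{a..b}. T v s = l * d * exp (z * of_real s)))"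

lemma symbol1D:
  assumes "symbol1 a b z T l" "\<And>s. s \<in> {a..b} \<Longrightarrow> v s = d * exp (z * of_real s)" "x \<in> {a..b}"
  shows "T v x = l * d * exp (z * of_real x)"
  using assms unfolding symbol1_def by simp

text \<open>The constant \<open>c\<close> takes in the part of the kernel exponent that depends on
  the outer variable, so that one antiderivative serves both kernels.\<close>

lemma integral_exp_affine:
  fixes w c :: complex
  assumes "p \<le> q" "w \<noteq> 0"
  shows "integral {p..q} (\<lambda>y. exp (w * of_real y + c)) =
           (exp (w * of_real q + c) - exp (w * of_real p + c)) / w"
proof -
  have "((\<lambda>y. exp (w * of_real y + c)) has_integral
          (exp (w * of_real q + c) / w - exp (w * of_real p + c) / w)) {p..q}"
  proof (rule fundamental_theorem_of_calculus[OF assms(1)])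
    fix y
    have "((\<lambda>t. exp (w * t + c) / w) has_field_derivative exp (w * of_real y + c)) (at (of_real y))"
      using assms(2) by (auto intro!: derivative_eq_intros)
    then show "((\<lambda>y. exp (w * of_real y + c) / w) has_vector_derivative exp (w * of_real y + c))
        (at y within {p..q})"
      using has_vector_derivative_real_field by blast
  qed
  then show ?thesis
    by (simp add: integral_unique diff_divide_distrib)
qed

text \<open>Kernel times mode is a single exponential of rate \<open>\<alpha> + z\<close>. The
  contribution of the endpoint \<open>a\<close> decays like the kernel; this is what the correction
  in \<open>Linv_L\<close> has to cancel.\<close>

lemma I_L_exp:
  assumes v: "\<And>s. s \<in> {a..b} \<Longrightarrow> v s = d * exp (z * of_real s)"
    and nz: "of_real \<alpha> + z \<noteq> 0" and x: "x \<in> {a..b}"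
  shows "I_L a b \<alpha> v x = of_real \<alpha> / (of_real \<alpha> + z) * d *
           (exp (z * of_real x) - of_real (exp (- \<alpha> * (x - a))) * exp (z * of_real a))"
proof -
  have "integral {a..x} (\<lambda>y. of_real (exp (- \<alpha> * (x - y))) * v y) =
        integral {a..x} (\<lambda>y. d * exp ((of_real \<alpha> + z) * of_real y + of_real (- \<alpha> * x)))"
    using x by (intro integral_cong) (auto simp: v exp_of_real[symmetric] exp_add[symmetric] algebra_simps)
  also have "\<dots> = d * ((exp ((of_real \<alpha> + z) * of_real x + of_real (- \<alpha> * x))
        - exp ((of_real \<alpha> + z) * of_real a + of_real (- \<alpha> * x))) / (of_real \<alpha> + z))"
    using x nz by (subst integral_mult_right, subst integral_exp_affine) auto
  also have "exp ((of_real \<alpha> + z) * of_real x + of_real (- \<alpha> * x)) = exp (z * of_real x)"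
    by (simp add: algebra_simps)
  also have "exp ((of_real \<alpha> + z) * of_real a + of_real (- \<alpha> * x)) =
      of_real (exp (- \<alpha> * (x - a))) * exp (z * of_real a)"
    by (simp add: exp_of_real[symmetric] exp_add[symmetric] algebra_simps)
  finally show ?thesis
    by (simp add: I_L_def)
qed

lemma I_R_exp:
  assumes v: "\<And>s. s \<in> {a..b} \<Longrightarrow> v s = d * exp (z * of_real s)"
    and nz: "of_real \<alpha> - z \<noteq> 0" and x: "x \<in> {a..b}"
  shows "I_R a b \<alpha> v x = of_real \<alpha> / (of_real \<alpha> - z) * d *
           (exp (z * of_real x) - of_real (exp (- \<alpha> * (b - x))) * exp (z * of_real b))"
proof -
  have nz': "z - of_real \<alpha> \<noteq> 0"
    using nz by auto
  have "integral {x..b} (\<lambda>y. of_real (exp (- \<alpha> * (y - x))) * v y) =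
        integral {x..b} (\<lambda>y. d * exp ((z - of_real \<alpha>) * of_real y + of_real (\<alpha> * x)))"
    using x by (intro integral_cong) (auto simp: v exp_of_real[symmetric] exp_add[symmetric] algebra_simps)
  also have "\<dots> = d * ((exp ((z - of_real \<alpha>) * of_real b + of_real (\<alpha> * x))
        - exp ((z - of_real \<alpha>) * of_real x + of_real (\<alpha> * x))) / (z - of_real \<alpha>))"
    using x nz' by (subst integral_mult_right, subst integral_exp_affine) auto
  also have "exp ((z - of_real \<alpha>) * of_real x + of_real (\<alpha> * x)) = exp (z * of_real x)"
    by (simp add: algebra_simps)
  also have "exp ((z - of_real \<alpha>) * of_real b + of_real (\<alpha> * x)) =
      of_real (exp (- \<alpha> * (b - x))) * exp (z * of_real b)"
    by (simp add: exp_of_real[symmetric] exp_add[symmetric] algebra_simps)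
  finally have int: "integral {x..b} (\<lambda>y. of_real (exp (- \<alpha> * (y - x))) * v y) =
      d * ((of_real (exp (- \<alpha> * (b - x))) * exp (z * of_real b) - exp (z * of_real x)) / (z - of_real \<alpha>))" .
  \<comment> \<open>The rate of the integrand is \<open>z - \<alpha>\<close>; flipping both signs
    gives the denominator \<open>\<alpha> - z\<close> that mirrors the left operator.\<close>
  have "(p - q) / (z - of_real \<alpha>) = (q - p) / (of_real \<alpha> - z)" for p q
    by (metis minus_diff_eq minus_divide_divide)
  then show ?thesis
    unfolding I_R_def int by simp
qed

lemma mu_less_1:
  assumes "0 < \<alpha>" "a < b"
  shows "mu a b \<alpha> < 1"
  using assms by (simp add: mu_def)

text \<open>Periodicity of the exponential makes \<open>I_L\<close> at \<open>b\<close> a multiple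
  of \<open>1 - mu a b \<alpha>\<close>. Dividing by that factor turns the correction into exactly
  the missing endpoint term, so \<open>Linv_L\<close> has eigenvalue
  \<open>\<alpha> / (\<alpha> + z)\<close>, and subtracting from the identity leaves
  \<open>z / (\<alpha> + z)\<close>.\<close>

lemma symbol1_D_L:
  assumes "0 < \<alpha>" "a < b" and nz: "of_real \<alpha> + z \<noteq> 0"
    and per: "exp (z * of_real b) = exp (z * of_real a)"
  shows "symbol1 a b z (D_L a b \<alpha>) (z / (of_real \<alpha> + z))"
  unfolding symbol1_def
proof (intro allI impI ballI)
  fix v d x assume v: "\<forall>s\<in>{a..b}. v s = d * exp (z * of_real s)" and x: "x \<in> {a..b}"
  have "of_real (1 - mu a b \<alpha>) \<noteq> (0::complex)"
    using mu_less_1[OF assms(1,2)] by (simp only: of_real_eq_0_iff)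
  moreover have "I_L a b \<alpha> v b = of_real \<alpha> / (of_real \<alpha> + z) * d * exp (z * of_real a) * of_real (1 - mu a b \<alpha>)"
  proof -
    have "I_L a b \<alpha> v b = of_real \<alpha> / (of_real \<alpha> + z) * d *
        (exp (z * of_real b) - of_real (exp (- \<alpha> * (b - a))) * exp (z * of_real a))"
      using v assms by (intro I_L_exp) auto
    moreover have "p * (e - q * e) = p * e * (1 - q)" for p e q :: complex
      by (simp add: algebra_simps)
    ultimately show ?thesis
      unfolding per mu_def of_real_diff of_real_1 by (simp only:)
  qed
  ultimately have q: "I_L a b \<alpha> v b / of_real (1 - mu a b \<alpha>) =
      of_real \<alpha> / (of_real \<alpha> + z) * d * exp (z * of_real a)"
    by simp
  have "I_L a b \<alpha> v x = of_real \<alpha> / (of_real \<alpha> + z) * d *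
           (exp (z * of_real x) - of_real (exp (- \<alpha> * (x - a))) * exp (z * of_real a))"
    using v x nz by (intro I_L_exp) auto
  \<comment> \<open>The endpoint terms cancel. Stating this for plain variables keeps the fractions
    inside \<open>p\<close> intact.\<close>
  moreover have "p * (e - r * f) + p * f * r = p * e" for p e r f :: complex
    by (simp add: algebra_simps)
  ultimately have "Linv_L a b \<alpha> v x = of_real \<alpha> / (of_real \<alpha> + z) * d * exp (z * of_real x)"
    unfolding Linv_L_def q by (simp only:)
  then show "D_L a b \<alpha> v x = z / (of_real \<alpha> + z) * d * exp (z * of_real x)"
    using v x nz by (simp add: D_L_def field_simps)
qed

text \<open>Mirror image of \<open>symbol1_D_L\<close>, with the endpoints exchanged and
  \<open>z\<close> replaced by \<open>- z\<close> in the eigenvalue.\<close>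

lemma symbol1_D_R:
  assumes "0 < \<alpha>" "a < b" and nz: "of_real \<alpha> - z \<noteq> 0"
    and per: "exp (z * of_real b) = exp (z * of_real a)"
  shows "symbol1 a b z (D_R a b \<alpha>) (- z / (of_real \<alpha> - z))"
  unfolding symbol1_def
proof (intro allI impI ballI)
  fix v d x assume v: "\<forall>s\<in>{a..b}. v s = d * exp (z * of_real s)" and x: "x \<in> {a..b}"
  have "of_real (1 - mu a b \<alpha>) \<noteq> (0::complex)"
    using mu_less_1[OF assms(1,2)] by (simp only: of_real_eq_0_iff)
  moreover have "I_R a b \<alpha> v a = of_real \<alpha> / (of_real \<alpha> - z) * d * exp (z * of_real b) * of_real (1 - mu a b \<alpha>)"
  proof -
    have "I_R a b \<alpha> v a = of_real \<alpha> / (of_real \<alpha> - z) * d *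
        (exp (z * of_real a) - of_real (exp (- \<alpha> * (b - a))) * exp (z * of_real b))"
      using v assms by (intro I_R_exp) auto
    moreover have "p * (e - q * e) = p * e * (1 - q)" for p e q :: complex
      by (simp add: algebra_simps)
    ultimately show ?thesis
      unfolding per mu_def of_real_diff of_real_1 by (simp only:)
  qed
  ultimately have q: "I_R a b \<alpha> v a / of_real (1 - mu a b \<alpha>) =
      of_real \<alpha> / (of_real \<alpha> - z) * d * exp (z * of_real b)"
    by simp
  have "I_R a b \<alpha> v x = of_real \<alpha> / (of_real \<alpha> - z) * d *
           (exp (z * of_real x) - of_real (exp (- \<alpha> * (b - x))) * exp (z * of_real b))"
    using v x nz by (intro I_R_exp) auto
  moreover have "p * (e - r * f) + p * f * r = p * e" for p e r f :: complex
    by (simp add: algebra_simps)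
  ultimately have "Linv_R a b \<alpha> v x = of_real \<alpha> / (of_real \<alpha> - z) * d * exp (z * of_real x)"
    unfolding Linv_R_def q by (simp only:)
  then show "D_R a b \<alpha> v x = - z / (of_real \<alpha> - z) * d * exp (z * of_real x)"
    using v x nz by (simp add: D_R_def field_simps)
qed

lemma symbol1_D_0:
  assumes "symbol1 a b z (D_L a b \<alpha>) l" "symbol1 a b z (D_R a b \<alpha>) m"
  shows "symbol1 a b z (D_0 a b \<alpha>) ((l + m) / 2)"
  unfolding symbol1_def
proof (intro allI impI ballI)
  fix v d x assume "\<forall>s\<in>{a..b}. v s = d * exp (z * of_real s)" and "x \<in> {a..b}"
  then have "D_L a b \<alpha> v x = l * d * exp (z * of_real x)" "D_R a b \<alpha> v x = m * d * exp (z * of_real x)"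
    using assms by (auto intro: symbol1D)
  then show "D_0 a b \<alpha> v x = (l + m) / 2 * d * exp (z * of_real x)"
    by (simp add: D_0_def ring_distribs add_divide_distrib)
qed

section \<open>Eigenvalues of the two-dimensional operators\<close>

text \<open>Equality is confined to the square so that it survives repeated application of the
  operators; a mode is recorded by its amplitude alone.\<close>

definition agrees :: "int \<Rightarrow> int \<Rightarrow> fun2 \<Rightarrow> complex \<Rightarrow> bool" where
  "agrees \<xi> \<eta> u c \<longleftrightarrow> (\<forall>x\<in>{0..2 * pi}. \<forall>y\<in>{0..2 * pi}. u x y = fourier_mode c \<xi> \<eta> x y)"

definition symbol2 :: "int \<Rightarrow> int \<Rightarrow> (fun2 \<Rightarrow> fun2) \<Rightarrow> complex \<Rightarrow> bool" where
  "symbol2 \<xi> \<eta> T l \<longleftrightarrow> (\<forall>u c. agrees \<xi> \<eta> u c \<longrightarrow> agrees \<xi> \<eta> (T u) (l * c))"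

text \<open>With \<open>y\<close> frozen, the factor
  \<open>exp (\<i> * of_int \<eta> * of_real y)\<close> joins the amplitude \<open>d\<close> of a
  one-dimensional exponential in \<open>x\<close>.\<close>

lemma agrees_in_x:
  assumes "symbol1 0 (2 * pi) (\<i> * of_int \<xi>) T l" "agrees \<xi> \<eta> u c"
  shows "agrees \<xi> \<eta> (in_x T u) (l * c)"
  unfolding agrees_def
proof (intro ballI)
  fix x y :: real assume x: "x \<in> {0..2*pi}" and y: "y \<in> {0..2*pi}"
  have "\<forall>s\<in>{0..2*pi}. u s y = (c * exp (\<i> * of_int \<eta> * of_real y)) * exp (\<i> * of_int \<xi> * of_real s)"
    using assms(2) y by (auto simp: agrees_def fourier_mode_def exp_add)
  then have "T (\<lambda>s. u s y) x = l * (c * exp (\<i> * of_int \<eta> * of_real y)) * exp (\<i> * of_int \<xi> * of_real x)"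
    using x by (intro symbol1D[OF assms(1)]) simp_all
  then show "in_x T u x y = fourier_mode (l * c) \<xi> \<eta> x y"
    by (simp add: in_x_def fourier_mode_def exp_add)
qed

lemma agrees_in_y:
  assumes "symbol1 0 (2 * pi) (\<i> * of_int \<eta>) T l" "agrees \<xi> \<eta> u c"
  shows "agrees \<xi> \<eta> (in_y T u) (l * c)"
  unfolding agrees_def
proof (intro ballI)
  fix x y :: real assume x: "x \<in> {0..2*pi}" and y: "y \<in> {0..2*pi}"
  have "\<forall>s\<in>{0..2*pi}. u x s = (c * exp (\<i> * of_int \<xi> * of_real x)) * exp (\<i> * of_int \<eta> * of_real s)"
    using assms(2) x by (auto simp: agrees_def fourier_mode_def exp_add)
  then have "T (\<lambda>s. u x s) y = l * (c * exp (\<i> * of_int \<xi> * of_real x)) * exp (\<i> * of_int \<eta> * of_real y)"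
    using y by (intro symbol1D[OF assms(1)]) simp_all
  then show "in_y T u x y = fourier_mode (l * c) \<xi> \<eta> x y"
    by (simp add: in_y_def fourier_mode_def exp_add)
qed

section \<open>Linear combinations and powers of operators acting on a mode\<close>

lemma agrees_diff:
  assumes "agrees \<xi> \<eta> u c" "agrees \<xi> \<eta> v d"
  shows "agrees \<xi> \<eta> (\<lambda>x y. u x y - v x y) (c - d)"
  using assms by (simp add: agrees_def fourier_mode_def algebra_simps)

lemma agrees_mult:
  assumes "agrees \<xi> \<eta> u c"
  shows "agrees \<xi> \<eta> (\<lambda>x y. a * u x y) (a * c)"
  using assms by (simp add: agrees_def fourier_mode_def)

lemma agrees_sum:
  assumes "\<And>p. p \<in> P \<Longrightarrow> agrees \<xi> \<eta> (u p) (c p)"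
  shows "agrees \<xi> \<eta> (\<lambda>x y. \<Sum>p\<in>P. u p x y) (\<Sum>p\<in>P. c p)"
  using assms by (simp add: agrees_def fourier_mode_def sum_distrib_right)

lemma agrees_funpow:
  assumes "symbol2 \<xi> \<eta> T l" "agrees \<xi> \<eta> u c"
  shows "agrees \<xi> \<eta> ((T ^^ n) u) (l ^ n * c)"
  using assms by (induction n) (auto simp: symbol2_def mult.assoc)

text \<open>Its square is the function whose supremum defines \<open>M_sup k\<close>. For fixed
  \<open>w\<close> it tends to \<open>w\<close> as \<open>k\<close> grows, matching the exact
  derivative.\<close>

definition g_fun :: "nat \<Rightarrow> real \<Rightarrow> real" where
  "g_fun k w = w * (1 - (w\<^sup>2 / (1 + w\<^sup>2)) ^ k)"

lemma g_fun_le: "(g_fun k w)\<^sup>2 \<le> M_sup k"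
  unfolding g_fun_def M_sup_def power_mult_distrib
  by (rule cSUP_upper[OF _ M_sup_bdd_above]) simp

section \<open>Closed form of the eigenvalues of the approximate derivatives\<close>

lemma real_add_ii_nonzero:
  assumes "0 < \<alpha>"
  shows "of_real \<alpha> + \<i> * of_int n \<noteq> 0" "of_real \<alpha> - \<i> * of_int n \<noteq> 0"
  using assms by (auto simp: complex_eq_iff)

text \<open>Integrality of the frequency enters here; this supplies the assumption
  \<open>per\<close> of \<open>symbol1_D_L\<close> and \<open>symbol1_D_R\<close>.\<close>

lemma exp_ii_periodic: "exp (\<i> * of_int n * of_real (2 * pi)) = exp (\<i> * of_int n * of_real 0)"
  using exp_two_pi_i by (simp add: exp_eq_1 mult_ac)

text \<open>Since \<open>z\<close> is imaginary, the common denominator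
  \<open>(\<alpha> + z) * (\<alpha> - z)\<close> is the positive real
  \<open>\<alpha>\<^sup>2 + n\<^sup>2\<close>; dividing through by \<open>\<alpha>\<^sup>2\<close>
  expresses everything in \<open>w\<close>.\<close>

lemma D_L_D_R_eigenvalues:
  fixes n :: int
  assumes "0 < \<alpha>"
  defines "z \<equiv> \<i> * complex_of_int n" and "w \<equiv> of_int n / \<alpha>"
  shows "z / (of_real \<alpha> + z) + - z / (of_real \<alpha> - z) = of_real (2 * (w\<^sup>2 / (1 + w\<^sup>2)))"
    and "z / (of_real \<alpha> + z) - - z / (of_real \<alpha> - z) = \<i> * of_real (2 * (w / (1 + w\<^sup>2)))"
proof -
  note nz = real_add_ii_nonzero[OF assms(1), of n, folded z_def]
  have zz: "z * z = - of_real ((of_int n)\<^sup>2)"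
    unfolding power2_eq_square[symmetric] by (simp add: z_def power_mult_distrib)
  have prod: "(of_real \<alpha> + z) * (of_real \<alpha> - z) = of_real (\<alpha>\<^sup>2 + (of_int n)\<^sup>2)"
    using zz by (simp add: algebra_simps power2_eq_square)
  have pos: "0 < \<alpha>\<^sup>2 + (of_int n)\<^sup>2"
    using assms(1) by (simp add: add_pos_nonneg)
  have "z / (of_real \<alpha> + z) + - z / (of_real \<alpha> - z) =
      - 2 * (z * z) / ((of_real \<alpha> + z) * (of_real \<alpha> - z))"
    using nz by (simp add: divide_simps) (simp add: algebra_simps)
  also have "\<dots> = of_real (2 * ((of_int n)\<^sup>2 / (\<alpha>\<^sup>2 + (of_int n)\<^sup>2)))"
    unfolding prod zz by simp
  also have "(of_int n)\<^sup>2 / (\<alpha>\<^sup>2 + (of_int n)\<^sup>2) = w\<^sup>2 / (1 + w\<^sup>2)"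
    using assms(1) pos by (simp add: w_def power_divide add_divide_eq_iff)
  finally show "z / (of_real \<alpha> + z) + - z / (of_real \<alpha> - z) = of_real (2 * (w\<^sup>2 / (1 + w\<^sup>2)))" .
  have "z / (of_real \<alpha> + z) - - z / (of_real \<alpha> - z) =
      2 * of_real \<alpha> * z / ((of_real \<alpha> + z) * (of_real \<alpha> - z))"
    using nz by (simp add: divide_simps) (simp add: algebra_simps)
  also have "\<dots> = \<i> * of_real (2 * (\<alpha> * of_int n / (\<alpha>\<^sup>2 + (of_int n)\<^sup>2)))"
    unfolding prod by (simp add: z_def)
  also have "\<alpha> * of_int n / (\<alpha>\<^sup>2 + (of_int n)\<^sup>2) = w / (1 + w\<^sup>2)"
    using assms(1) pos by (simp add: w_def power_divide add_divide_eq_iff power2_eq_square)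
  finally show "z / (of_real \<alpha> + z) - - z / (of_real \<alpha> - z) = \<i> * of_real (2 * (w / (1 + w\<^sup>2)))" .
qed

text \<open>With \<open>r = w\<^sup>2 / (1 + w\<^sup>2)\<close> the factor
  \<open>w / (1 + w\<^sup>2)\<close> is \<open>w * (1 - r)\<close>, and \<open>1 - r\<close>
  telescopes the geometric sum.\<close>

lemma geometric_g_fun:
  "(\<Sum>p = 1..k. (w\<^sup>2 / (1 + w\<^sup>2)) ^ (p - 1)) * (w / (1 + w\<^sup>2)) = g_fun k w"
proof -
  define r where "r = w\<^sup>2 / (1 + w\<^sup>2)"
  have pos: "0 < 1 + w\<^sup>2"
    by (simp add: add_pos_nonneg)
  have r: "1 - r = 1 / (1 + w\<^sup>2)"
    using pos by (simp add: r_def field_simps)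
  have "(\<Sum>p = 1..k. r ^ (p - 1)) = (\<Sum>p<k. r ^ p)"
    by (rule sum.reindex_bij_witness[of _ Suc "\<lambda>p. p - 1"]) auto
  moreover have "1 - r ^ k = (1 - r) * (\<Sum>p<k. r ^ p)"
    by (rule one_diff_power_eq)
  ultimately show ?thesis
    unfolding r_def[symmetric] g_fun_def by (simp add: r)
qed

text \<open>The left-hand side is the amplitude as the rules for \<open>agrees\<close> assemble it,
  so \<open>partial_x\<close> and \<open>partial_y\<close> share this evaluation.\<close>

lemma partial_eigenvalue:
  fixes n :: int
  assumes "0 < \<alpha>"
  defines "z \<equiv> \<i> * complex_of_int n"
  defines "l \<equiv> z / (of_real \<alpha> + z)" and "m \<equiv> - z / (of_real \<alpha> - z)"
  shows "of_real (\<alpha> / 2) * (\<Sum>p = 1..k. ((l + m) / 2) ^ (p - 1) * (l * c - m * c)) =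
           \<i> * of_real (\<alpha> * g_fun k (of_int n / \<alpha>)) * c"
proof -
  define w where "w = of_int n / \<alpha>"
  have "l + m = of_real (2 * (w\<^sup>2 / (1 + w\<^sup>2)))"
    unfolding l_def m_def z_def w_def by (rule D_L_D_R_eigenvalues(1)[OF assms(1)])
  then have avg: "(l + m) / 2 = of_real (w\<^sup>2 / (1 + w\<^sup>2))"
    by (simp only: of_real_mult of_real_numeral nonzero_mult_div_cancel_left zero_neq_numeral[symmetric] not_False_eq_True)
  have diff: "l - m = \<i> * of_real (2 * (w / (1 + w\<^sup>2)))"
    unfolding l_def m_def z_def w_def by (rule D_L_D_R_eigenvalues(2)[OF assms(1)])
  have "of_real (\<alpha> / 2) * (\<Sum>p = 1..k. ((l + m) / 2) ^ (p - 1) * (l * c - m * c)) =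
      of_real (\<alpha> / 2) * (\<Sum>p = 1..k. of_real (w\<^sup>2 / (1 + w\<^sup>2)) ^ (p - 1)) * (l - m) * c"
    unfolding avg left_diff_distrib[symmetric] sum_distrib_right[symmetric] by (simp only: mult.assoc)
  also have "\<dots> = \<i> * of_real (\<alpha> * ((\<Sum>p = 1..k. (w\<^sup>2 / (1 + w\<^sup>2)) ^ (p - 1)) * (w / (1 + w\<^sup>2)))) * c"
    unfolding diff by simp
  finally show ?thesis
    unfolding geometric_g_fun w_def .
qed

lemma symbol2_partial_x:
  assumes "0 < \<alpha>"
  shows "symbol2 \<xi> \<eta> (partial_x \<alpha> k) (\<i> * of_real (\<alpha> * g_fun k (of_int \<xi> / \<alpha>)))"
  unfolding symbol2_def
proof (intro allI impI)
  fix u c assume u: "agrees \<xi> \<eta> u c"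
  define z where "z = \<i> * complex_of_int \<xi>"
  define l where "l = z / (of_real \<alpha> + z)"
  define m where "m = - z / (of_real \<alpha> - z)"
  note nz = real_add_ii_nonzero[OF assms, of \<xi>, folded z_def]
  have L: "symbol1 0 (2 * pi) (\<i> * of_int \<xi>) (D_L 0 (2 * pi) \<alpha>) l"
    unfolding l_def z_def using assms nz exp_ii_periodic[of \<xi>]
    by (intro symbol1_D_L) (simp_all add: z_def)
  have R: "symbol1 0 (2 * pi) (\<i> * of_int \<xi>) (D_R 0 (2 * pi) \<alpha>) m"
    unfolding m_def z_def using assms nz exp_ii_periodic[of \<xi>]
    by (intro symbol1_D_R) (simp_all add: z_def)
  have "symbol2 \<xi> \<eta> (in_x (D_0 0 (2 * pi) \<alpha>)) ((l + m) / 2)"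
    unfolding symbol2_def using agrees_in_x[OF symbol1_D_0[OF L R]] by blast
  then have "agrees \<xi> \<eta> (partial_x \<alpha> k u)
      (of_real (\<alpha> / 2) * (\<Sum>p = 1..k. ((l + m) / 2) ^ (p - 1) * (l * c - m * c)))"
    unfolding partial_x_def
    by (intro agrees_mult agrees_sum agrees_funpow agrees_diff agrees_in_x L R u)
  then show "agrees \<xi> \<eta> (partial_x \<alpha> k u) (\<i> * of_real (\<alpha> * g_fun k (of_int \<xi> / \<alpha>)) * c)"
    unfolding l_def m_def z_def partial_eigenvalue[OF assms] .
qed

lemma symbol2_partial_y:
  assumes "0 < \<alpha>"
  shows "symbol2 \<xi> \<eta> (partial_y \<alpha> k) (\<i> * of_real (\<alpha> * g_fun k (of_int \<eta> / \<alpha>)))"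
  unfolding symbol2_def
proof (intro allI impI)
  fix u c assume u: "agrees \<xi> \<eta> u c"
  define z where "z = \<i> * complex_of_int \<eta>"
  define l where "l = z / (of_real \<alpha> + z)"
  define m where "m = - z / (of_real \<alpha> - z)"
  note nz = real_add_ii_nonzero[OF assms, of \<eta>, folded z_def]
  have L: "symbol1 0 (2 * pi) (\<i> * of_int \<eta>) (D_L 0 (2 * pi) \<alpha>) l"
    unfolding l_def z_def using assms nz exp_ii_periodic[of \<eta>]
    by (intro symbol1_D_L) (simp_all add: z_def)
  have R: "symbol1 0 (2 * pi) (\<i> * of_int \<eta>) (D_R 0 (2 * pi) \<alpha>) m"
    unfolding m_def z_def using assms nz exp_ii_periodic[of \<eta>]
    by (intro symbol1_D_R) (simp_all add: z_def)
  have "symbol2 \<xi> \<eta> (in_y (D_0 0 (2 * pi) \<alpha>)) ((l + m) / 2)"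
    unfolding symbol2_def using agrees_in_y[OF symbol1_D_0[OF L R]] by blast
  then have "agrees \<xi> \<eta> (partial_y \<alpha> k u)
      (of_real (\<alpha> / 2) * (\<Sum>p = 1..k. ((l + m) / 2) ^ (p - 1) * (l * c - m * c)))"
    unfolding partial_y_def
    by (intro agrees_mult agrees_sum agrees_funpow agrees_diff agrees_in_y L R u)
  then show "agrees \<xi> \<eta> (partial_y \<alpha> k u) (\<i> * of_real (\<alpha> * g_fun k (of_int \<eta> / \<alpha>)) * c)"
    unfolding l_def m_def z_def partial_eigenvalue[OF assms] .
qed

section \<open>The amplification factor\<close>

text \<open>Nonnegativity keeps the amplification factor at most \<open>1\<close> and later bounds
  the mixed term; the positive diagonal makes both kernel parameters positive.\<close>

lemma parabolic_form_nonneg: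
  assumes "parabolic A"
  shows "0 \<le> A $ 1 $ 1 * s\<^sup>2 + (A $ 1 $ 2 + A $ 2 $ 1) * s * t + A $ 2 $ 2 * t\<^sup>2"
    and "0 < A $ 1 $ 1" and "0 < A $ 2 $ 2"
proof -
  obtain \<theta> where \<theta>: "\<theta> > 0" and
    *: "\<And>\<xi>::real^2. (\<Sum>i\<in>UNIV. \<Sum>j\<in>UNIV. A $ i $ j * \<xi> $ i * \<xi> $ j) \<ge> \<theta> * ((\<xi> $ 1)\<^sup>2 + (\<xi> $ 2)\<^sup>2)"
    using assms unfolding parabolic_def by blast
  have form: "\<theta> * (s\<^sup>2 + t\<^sup>2) \<le> A $ 1 $ 1 * s\<^sup>2 + (A $ 1 $ 2 + A $ 2 $ 1) * s * t + A $ 2 $ 2 * t\<^sup>2" for s t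
    using *[of "vector [s, t]"] by (simp add: sum_2 power2_eq_square algebra_simps)
  have "0 \<le> \<theta> * (s\<^sup>2 + t\<^sup>2)"
    using \<theta> by simp
  with form show "0 \<le> A $ 1 $ 1 * s\<^sup>2 + (A $ 1 $ 2 + A $ 2 $ 1) * s * t + A $ 2 $ 2 * t\<^sup>2"
    by (rule order_trans[rotated])
  show "0 < A $ 1 $ 1" "0 < A $ 2 $ 2"
    using form[of 1 0] form[of 0 1] \<theta> by simp_all
qed

text \<open>The derivatives act on a mode as \<open>\<i> * s\<close> and \<open>\<i> * t\<close>
  with real \<open>s\<close>, \<open>t\<close>, so the amplification factor is
  \<open>1 - dt * F\<close> with \<open>F\<close> the quadratic form at \<open>(s, t)\<close>.
  Parabolicity gives \<open>0 \<le> dt * F\<close>; only the upper bound \<open>2\<close> differs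
  between the two cases and is left as the assumption \<open>bound\<close>.\<close>

lemma A_stable_scheme:
  fixes A :: "real^2^2"
  assumes par: "parabolic A" and "0 < \<beta>"
    and bound: "\<And>dt s t. 0 < dt \<Longrightarrow> A $ 1 $ 1 * dt * s\<^sup>2 \<le> \<beta> * M_sup k \<Longrightarrow> A $ 2 $ 2 * dt * t\<^sup>2 \<le> \<beta> * M_sup k \<Longrightarrow>
        dt * (A $ 1 $ 1 * s\<^sup>2 + (A $ 1 $ 2 + A $ 2 $ 1) * s * t + A $ 2 $ 2 * t\<^sup>2) \<le> 2"
  shows "A_stable (scheme_step A k \<beta>)"
  unfolding A_stable_def
proof (intro allI impI)
  fix dt :: real and \<xi> \<eta> :: int
  assume dt: "0 < dt"
  note pos = parabolic_form_nonneg(2,3)[OF par]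
  define ax where "ax = sqrt (\<beta> / (A $ 1 $ 1 * dt))"
  define ay where "ay = sqrt (\<beta> / (A $ 2 $ 2 * dt))"
  \<comment> \<open>This normalization removes \<open>dt\<close> from the bounds on the diagonal
    terms, which makes stability unconditional in the time step.\<close>
  have ax: "0 < ax" "A $ 1 $ 1 * dt * ax\<^sup>2 = \<beta>" and ay: "0 < ay" "A $ 2 $ 2 * dt * ay\<^sup>2 = \<beta>"
    using pos dt \<open>0 < \<beta>\<close> by (auto simp: ax_def ay_def)
  define s where "s = ax * g_fun k (of_int \<xi> / ax)"
  define t where "t = ay * g_fun k (of_int \<eta> / ay)"
  have "A $ 1 $ 1 * dt * s\<^sup>2 = A $ 1 $ 1 * dt * ax\<^sup>2 * (g_fun k (of_int \<xi> / ax))\<^sup>2"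
    by (simp add: s_def power_mult_distrib)
  also have "\<dots> \<le> \<beta> * M_sup k"
    using \<open>0 < \<beta>\<close> by (simp add: ax g_fun_le)
  finally have s: "A $ 1 $ 1 * dt * s\<^sup>2 \<le> \<beta> * M_sup k" .
  have "A $ 2 $ 2 * dt * t\<^sup>2 = A $ 2 $ 2 * dt * ay\<^sup>2 * (g_fun k (of_int \<eta> / ay))\<^sup>2"
    by (simp add: t_def power_mult_distrib)
  also have "\<dots> \<le> \<beta> * M_sup k"
    using \<open>0 < \<beta>\<close> by (simp add: ay g_fun_le)
  finally have t: "A $ 2 $ 2 * dt * t\<^sup>2 \<le> \<beta> * M_sup k" .
  define F where "F = A $ 1 $ 1 * s\<^sup>2 + (A $ 1 $ 2 + A $ 2 $ 1) * s * t + A $ 2 $ 2 * t\<^sup>2"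
  have "0 \<le> dt * F"
    using parabolic_form_nonneg(1)[OF par, of s t] dt by (simp add: F_def)
  moreover have "dt * F \<le> 2"
    unfolding F_def by (rule bound[OF dt s t])
  ultimately have "cmod (of_real (1 - dt * F)) \<le> 1"
    unfolding norm_of_real by linarith
  moreover have "scheme_step A k \<beta> dt (fourier_mode c \<xi> \<eta>) x y =
      of_real (1 - dt * F) * fourier_mode c \<xi> \<eta> x y"
    if xy: "x \<in> {0..2 * pi}" "y \<in> {0..2 * pi}" for c x y
  proof -
    have X: "agrees \<xi> \<eta> (partial_x ax k u) (\<i> * of_real s * d)" if "agrees \<xi> \<eta> u d" for u d
      using symbol2_partial_x[OF ax(1), of \<xi> \<eta> k] that unfolding symbol2_def s_def by blast
    have Y: "agrees \<xi> \<eta> (partial_y ay k u) (\<i> * of_real t * d)" if "agrees \<xi> \<eta> u d" for u d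
      using symbol2_partial_y[OF ay(1), of \<xi> \<eta> k] that unfolding symbol2_def t_def by blast
    let ?u = "fourier_mode c \<xi> \<eta>"
    have u: "agrees \<xi> \<eta> ?u c"
      by (simp add: agrees_def)
    \<comment> \<open>Factoring out the mode of amplitude \<open>1\<close> turns every term of the
      step into a multiple of one common value; the two factors \<open>\<i>\<close> then give the
      minus sign.\<close>
    have val: "v x y = d * fourier_mode 1 \<xi> \<eta> x y" if "agrees \<xi> \<eta> v d" for v d
      using that xy by (simp add: agrees_def fourier_mode_def)
    show ?thesis
      unfolding scheme_step_def Let_def ax_def[symmetric] ay_def[symmetric]
        val[OF X[OF X[OF u]]] val[OF Y[OF X[OF u]]] val[OF X[OF Y[OF u]]] val[OF Y[OF Y[OF u]]] val[OF u]
      by (simp add: F_def algebra_simps power2_eq_square)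
  qed
  ultimately show "\<exists>Q. cmod Q \<le> 1 \<and> (\<forall>c. \<forall>x\<in>{0..2 * pi}. \<forall>y\<in>{0..2 * pi}.
      scheme_step A k \<beta> dt (fourier_mode c \<xi> \<eta>) x y = Q * fourier_mode c \<xi> \<eta> x y)"
    by blast
qed

section \<open>The two coefficient cases\<close>

theorem theorem4p1:
  fixes A :: "real^2^2" and k :: nat
  assumes "k \<ge> 1"
    and "parabolic A"
  shows "(A $ 1 $ 2 = 0 \<and> A $ 2 $ 1 = 0 \<longrightarrow>
            (\<forall>\<beta>. 0 < \<beta> \<and> \<beta> \<le> beta2_max k / 2 \<longrightarrow> A_stable (scheme_step A k \<beta>)))
       \<and> (\<not> (A $ 1 $ 2 = 0 \<and> A $ 2 $ 1 = 0) \<longrightarrow>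
            (\<forall>\<beta>. 0 < \<beta> \<and> \<beta> \<le> beta2_max k / 4 \<longrightarrow> A_stable (scheme_step A k \<beta>)))"
proof -
  note M = M_sup_pos[OF assms(1)]
  have "A_stable (scheme_step A k \<beta>)"
    if diag: "A $ 1 $ 2 = 0" "A $ 2 $ 1 = 0" and \<beta>: "0 < \<beta>" "\<beta> \<le> beta2_max k / 2" for \<beta>
  proof (rule A_stable_scheme[OF assms(2) \<beta>(1)])
    fix dt s t :: real
    assume st: "A $ 1 $ 1 * dt * s\<^sup>2 \<le> \<beta> * M_sup k" "A $ 2 $ 2 * dt * t\<^sup>2 \<le> \<beta> * M_sup k"
    \<comment> \<open>As \<open>beta2_max k\<close> is \<open>2 / M_sup k\<close>, each of the two
      diagonal terms is at most \<open>1\<close>.\<close>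
    have "\<beta> * M_sup k \<le> 1"
      using \<beta>(2) M by (simp add: beta2_max_def field_simps)
    then show "dt * (A $ 1 $ 1 * s\<^sup>2 + (A $ 1 $ 2 + A $ 2 $ 1) * s * t + A $ 2 $ 2 * t\<^sup>2) \<le> 2"
      using st by (simp add: diag algebra_simps)
  qed
  moreover have "A_stable (scheme_step A k \<beta>)" if \<beta>: "0 < \<beta>" "\<beta> \<le> beta2_max k / 4" for \<beta>
  proof (rule A_stable_scheme[OF assms(2) \<beta>(1)])
    fix dt s t :: real
    assume dt: "0 < dt"
      and st: "A $ 1 $ 1 * dt * s\<^sup>2 \<le> \<beta> * M_sup k" "A $ 2 $ 2 * dt * t\<^sup>2 \<le> \<beta> * M_sup k"
    \<comment> \<open>The form at \<open>(s, -t)\<close> is nonnegative, so the mixed term is at most the diagonal part.\<close>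
    have mixed: "(A $ 1 $ 2 + A $ 2 $ 1) * s * t \<le> A $ 1 $ 1 * s\<^sup>2 + A $ 2 $ 2 * t\<^sup>2"
      using parabolic_form_nonneg(1)[OF assms(2), of s "- t"] by simp
    have "p + q + r \<le> 2 * (p + r)" if "q \<le> p + r" for p q r :: real
      using that by simp
    from this[OF mixed] have "dt * (A $ 1 $ 1 * s\<^sup>2 + (A $ 1 $ 2 + A $ 2 $ 1) * s * t + A $ 2 $ 2 * t\<^sup>2) \<le>
        dt * (2 * (A $ 1 $ 1 * s\<^sup>2 + A $ 2 $ 2 * t\<^sup>2))"
      using less_imp_le[OF dt] by (rule mult_left_mono)
    also have "\<dots> = 2 * (A $ 1 $ 1 * dt * s\<^sup>2) + 2 * (A $ 2 $ 2 * dt * t\<^sup>2)"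
      by (simp add: algebra_simps)
    \<comment> \<open>Absorbing the mixed term doubles both diagonal terms, hence four copies of
      \<open>\<beta> * M_sup k\<close>; the quarter in the assumption on \<open>\<beta>\<close>
      makes each copy at most \<open>1/2\<close>.\<close>
    also have "\<dots> \<le> 4 * (\<beta> * M_sup k)"
      using st by linarith
    also have "\<dots> \<le> 2"
      using \<beta>(2) M by (simp add: beta2_max_def field_simps)
    finally show "dt * (A $ 1 $ 1 * s\<^sup>2 + (A $ 1 $ 2 + A $ 2 $ 1) * s * t + A $ 2 $ 2 * t\<^sup>2) \<le> 2" .
  qed
  ultimately show ?thesis
    by blast
qed

end
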